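(* For $k\ge 0$ let $L_k$ be the $2^k\times 2^k$ Latin square defined by $L_0=(1)$ and $L_k=\begin{pmatrix} L_{k-1}+2^{k-1} & L_{k-1}\\ L_{k-1} & L_{k-1}+2^{k-1}\end{pmatrix}$ for $k\ge1$ (equivalently, the $k$-fold tensor product of $\begin{pmatrix}2&1\\1&2\end{pmatrix}$). Then, with $n=2^k$, $(L_k,\mathrm{lex})$ contains a greedy defining set of cardinality $n^2-\Omega(n^{1.673})$ (as $k\to\infty$).
   Context: For a Latin square $L$ on $\{1,\ldots,n\}$ and an integer $p$, $L+p$ is obtained by adding $p$ to every entry. A Latin square of order $n$ with entries in $\{1,\ldots,n\}$ is regarded as a proper coloring of $K_n\Box K_n$ (cells are vertices; two cells are adjacent iff they share a row or column), with cells ordered lexicographically (row by row, top to bottom, each row left to right). First-Fit subject to a pre-coloring of a set $S$ of cells: cells of $S$ keep their given values; other cells are scanned in order and each gets the smallest positive integer not used on its already colored neighbors (cells of $S$ count as colored from the start). $S$ is a greedy defining set of $(L,\mathrm{lex})$ if First-Fit subject to the entries of $L$ on $S$ reproduces $L$. *)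

theory Defs
  imports Complex_Main "HOL-Library.Landau_Symbols"
begin

text \<open>Rows and columns are indexed by \<open>0, \<dots>, n - 1\<close>; entries are \<open>1, \<dots>, n\<close>.\<close>

type_synonym cell = "nat \<times> nat"

definition cells :: "nat \<Rightarrow> cell set" where
  "cells n = {..<n} \<times> {..<n}"

definition latin_square :: "nat \<Rightarrow> (cell \<Rightarrow> nat) \<Rightarrow> bool" where
  "latin_square n L \<longleftrightarrow>
     (\<forall>i<n. bij_betw (\<lambda>j. L (i, j)) {..<n} {1..n}) \<and>
     (\<forall>j<n. bij_betw (\<lambda>i. L (i, j)) {..<n} {1..n})"

definition rook_adj :: "cell \<Rightarrow> cell \<Rightarrow> bool" where
  "rook_adj u v \<longleftrightarrow> u \<noteq> v \<and> (fst u = fst v \<or> snd u = snd v)"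

definition lex_cells :: "nat \<Rightarrow> cell list" where
  "lex_cells n = List.product [0..<n] [0..<n]"

text \<open>Partial colorings are maps; the domain is the set of cells colored so far.\<close>

definition first_fit_color :: "('v \<Rightarrow> 'v \<Rightarrow> bool) \<Rightarrow> ('v \<rightharpoonup> nat) \<Rightarrow> 'v \<Rightarrow> nat" where
  "first_fit_color adj f v = (LEAST c. 1 \<le> c \<and> (\<forall>u\<in>dom f. adj u v \<longrightarrow> f u \<noteq> Some c))"

definition first_fit :: "('v \<Rightarrow> 'v \<Rightarrow> bool) \<Rightarrow> 'v list \<Rightarrow> ('v \<rightharpoonup> nat) \<Rightarrow> ('v \<rightharpoonup> nat)" where
  "first_fit adj vs p =
     fold (\<lambda>v f. if v \<in> dom p then f else f(v \<mapsto> first_fit_color adj f v)) vs p"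

definition greedy_defining_set_lex :: "nat \<Rightarrow> (cell \<Rightarrow> nat) \<Rightarrow> cell set \<Rightarrow> bool" where
  "greedy_defining_set_lex n L S \<longleftrightarrow>
     S \<subseteq> cells n \<and>
     (\<forall>v\<in>cells n. first_fit rook_adj (lex_cells n) ((Some \<circ> L) |` S) v = Some (L v))"

text \<open>Only the values on \<open>cells (2 ^ k)\<close> are meaningful; in the recursion,
  \<open>i mod 2 ^ k\<close> and \<open>j mod 2 ^ k\<close> are the coordinates inside a block.\<close>

fun tensor_square :: "nat \<Rightarrow> cell \<Rightarrow> nat" where
  "tensor_square 0 (i, j) = 1"
| "tensor_square (Suc k) (i, j) =
     (if i < 2 ^ k \<longleftrightarrow> j < 2 ^ k
      then tensor_square k (i mod 2 ^ k, j mod 2 ^ k) + 2 ^ k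
      else tensor_square k (i mod 2 ^ k, j mod 2 ^ k))"

lemma tensor_square_sym: "tensor_square k (i, j) = tensor_square k (j, i)"
proof (induction k arbitrary: i j)
  case (Suc k)
  show ?case using Suc[of "i mod 2 ^ k" "j mod 2 ^ k"] by (simp add: eq_commute)
qed simp

lemma tensor_square_range: "tensor_square k (i, j) \<in> {1..2 ^ k}"
proof (induction k arbitrary: i j)
  case (Suc k)
  show ?case using Suc[of "i mod 2 ^ k" "j mod 2 ^ k"] by auto
qed simp

lemma tensor_square_inj:
  "j < 2 ^ k \<Longrightarrow> j' < 2 ^ k \<Longrightarrow> tensor_square k (i, j) = tensor_square k (i, j') \<Longrightarrow> j = j'"
proof (induction k arbitrary: i j j')
  case (Suc k)
  let ?m = "2 ^ k :: nat"
  have r: "tensor_square k (i mod ?m, x) \<le> ?m" "1 \<le> tensor_square k (i mod ?m, x)" for x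
    using tensor_square_range[of k "i mod ?m" x] by auto
  have half: "j < ?m \<longleftrightarrow> j' < ?m"
    using Suc.prems(3) r[of "j mod ?m"] r[of "j' mod ?m"] by (auto split: if_splits)
  then have "tensor_square k (i mod ?m, j mod ?m) = tensor_square k (i mod ?m, j' mod ?m)"
    using Suc.prems(3) by (auto split: if_splits)
  then have eq: "j mod ?m = j' mod ?m"
    by (rule Suc.IH[rotated 2]) simp_all
  have "x div ?m = (if x < ?m then 0 else 1)" if "x < 2 ^ Suc k" for x :: nat
    using that by (simp add: le_div_geq)
  then have "j div ?m = j' div ?m"
    using half Suc.prems(1,2) by simp
  with eq show ?case
    by (metis div_mult_mod_eq)
qed simp

lemma latin_square_tensor_square: "latin_square (2 ^ k) (tensor_square k)"
proof -
  have row: "bij_betw (\<lambda>j. tensor_square k (i, j)) {..<2 ^ k} {1..2 ^ k}" for i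
  proof -
    have inj: "inj_on (\<lambda>j. tensor_square k (i, j)) {..<2 ^ k}"
      by (auto intro!: inj_onI dest: tensor_square_inj)
    have "(\<lambda>j. tensor_square k (i, j)) ` {..<2 ^ k} = {1..2 ^ k}"
      using tensor_square_range by (intro card_subset_eq) (auto simp: card_image[OF inj])
    with inj show ?thesis by (simp add: bij_betw_def)
  qed
  then show ?thesis
    unfolding latin_square_def by (subst (2) tensor_square_sym) blast
qed

end

theory Submission
  imports Defs "HOL-Library.Product_Lexorder"
begin

unbundle bit_operations_syntax

text \<open>A cell \<open>(i, j)\<close> left to First-Fit goes wrong only if some color smaller than its own occurs, in
  row \<open>i\<close> and in column \<open>j\<close>, only on later cells that are also left to First-Fit. So the complement
  of a set \<open>U\<close> is a greedy defining set as soon as \<open>U\<close> contains no descent: three cells \<open>(i, j)\<close>,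
  \<open>(i', j)\<close>, \<open>(i, j')\<close> with \<open>i < i'\<close>, \<open>j < j'\<close>, the last two carrying the same entry, smaller
  than the first. The entry of \<open>L\<^sub>k\<close> in cell \<open>(i, j)\<close> is \<open>2 ^ k - (i XOR j)\<close>, so \<open>i'\<close> and \<open>j'\<close> are
  \<open>i XOR d\<close> and \<open>j XOR d\<close> for a common \<open>d\<close>: descents are the corners in the group
  \<open>(\<int>/2)\<^sup>k\<close> that increase both coordinates. Products of sets without such corners have none either,
  and \<open>L\<^sub>3\<close> has such a set of 35 cells, found by computer search. Its powers give
  \<open>35 ^ (k div 3)\<close> cells in \<open>L\<^sub>k\<close>, which suffices because \<open>2 powr (3 * 1.673) \<le> 35\<close>.\<close>

section \<open>First-Fit\<close>

lemma dom_Some_comp_restrict: "dom ((Some \<circ> f) |` A) = A"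
  by auto

lemma first_fit_color_restrict_eqI:
  assumes "1 \<le> f v"
    and "\<And>u. u \<in> A \<Longrightarrow> adj u v \<Longrightarrow> f u \<noteq> f v"
    and "\<And>c. 1 \<le> c \<Longrightarrow> c < f v \<Longrightarrow> \<exists>u\<in>A. adj u v \<and> f u = c"
  shows "first_fit_color adj ((Some \<circ> f) |` A) v = f v"
proof -
  have "first_fit_color adj ((Some \<circ> f) |` A) v = (LEAST c. 1 \<le> c \<and> (\<forall>u\<in>A. adj u v \<longrightarrow> f u \<noteq> c))"
    unfolding first_fit_color_def dom_Some_comp_restrict by simp
  also have "\<dots> = f v"
    using assms by (intro Least_equality) (auto simp: not_less[symmetric])
  finally show ?thesis .
qed

lemma first_fit_restrict_eqI:
  assumes "\<And>xs v ys. vs = xs @ v # ys \<Longrightarrow> v \<notin> A \<Longrightarrow>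
    first_fit_color adj ((Some \<circ> f) |` (A \<union> set xs)) v = f v"
  shows "first_fit adj vs ((Some \<circ> f) |` A) = (Some \<circ> f) |` (A \<union> set vs)"
  using assms
proof (induction vs rule: rev_induct)
  case Nil
  show ?case by (simp add: first_fit_def)
next
  case (snoc v xs)
  have prefix_reproduced: "first_fit adj xs ((Some \<circ> f) |` A) = (Some \<circ> f) |` (A \<union> set xs)"
    by (rule snoc.IH) (use snoc.prems in auto)
  have color: "first_fit_color adj ((Some \<circ> f) |` (A \<union> set xs)) v = f v" if "v \<notin> A"
    by (rule snoc.prems[of xs v "[]"]) (simp_all add: that)
  have append: "first_fit adj (xs @ [v]) p =
      (if v \<in> dom p then first_fit adj xs p
       else (first_fit adj xs p)(v \<mapsto> first_fit_color adj (first_fit adj xs p) v))" for p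
    by (simp add: first_fit_def)
  show ?case
  proof (cases "v \<in> A")
    case True
    then have "A \<union> set (xs @ [v]) = A \<union> set xs"
      by auto
    with True show ?thesis
      using prefix_reproduced by (simp only: append dom_Some_comp_restrict if_True)
  next
    case False
    then have "first_fit adj (xs @ [v]) ((Some \<circ> f) |` A) =
        ((Some \<circ> f) |` (A \<union> set xs))(v \<mapsto> f v)"
      using prefix_reproduced color[OF False] by (simp only: append dom_Some_comp_restrict if_False)
    also have "\<dots> = (Some \<circ> f) |` (A \<union> set (xs @ [v]))"
      by (auto simp: fun_eq_iff restrict_map_def)
    finally show ?thesis .
  qed
qed

lemma sorted_wrt_less_product:
  fixes xs :: "'a::linorder list" and ys :: "'b::linorder list"
  assumes "sorted_wrt (<) xs" "sorted_wrt (<) ys"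
  shows "sorted_wrt (<) (List.product xs ys)"
  using assms by (induction xs) (auto simp: sorted_wrt_append sorted_wrt_map)

lemma set_lex_cells: "set (lex_cells n) = cells n"
  by (auto simp: lex_cells_def cells_def)

lemma lex_cells_prefix:
  assumes "lex_cells n = xs @ v # ys" "u \<in> cells n" "u < v"
  shows "u \<in> set xs"
proof -
  have "sorted_wrt (<) (xs @ v # ys)"
    unfolding assms(1)[symmetric] lex_cells_def by (simp add: sorted_wrt_less_product)
  moreover have "u \<in> set (xs @ v # ys)"
    using assms(1,2) set_lex_cells by metis
  ultimately show ?thesis
    using assms(3) by (auto simp: sorted_wrt_append)
qed

section \<open>Descents in Latin squares\<close>

definition descent_free :: "(cell \<Rightarrow> nat) \<Rightarrow> cell set \<Rightarrow> bool" where
  "descent_free L U \<longleftrightarrow>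
     (\<forall>i i' j j'. i < i' \<longrightarrow> j < j' \<longrightarrow> {(i, j), (i', j), (i, j')} \<subseteq> U \<longrightarrow>
        L (i', j) = L (i, j') \<longrightarrow> L (i, j) \<le> L (i, j'))"

lemma latin_square_adj_neq:
  assumes "latin_square n L" "u \<in> cells n" "v \<in> cells n" "rook_adj u v"
  shows "L u \<noteq> L v"
proof -
  obtain i j i' j' where coordinates: "u = (i, j)" "v = (i', j')"
    by (metis surj_pair)
  have "inj_on (\<lambda>j. L (i, j)) {..<n}" "inj_on (\<lambda>i. L (i, j)) {..<n}"
    using assms unfolding latin_square_def bij_betw_def coordinates cells_def by auto
  then show ?thesis
    using assms unfolding coordinates rook_adj_def cells_def by (auto dest: inj_onD)
qed

lemma latin_square_range:
  assumes "latin_square n L" "v \<in> cells n"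
  shows "L v \<in> {1..n}"
proof -
  have "bij_betw (\<lambda>j. L (fst v, j)) {..<n} {1..n}" "snd v \<in> {..<n}"
    using assms by (auto simp: latin_square_def cells_def)
  then show ?thesis
    using bij_betw_apply by fastforce
qed

lemma latin_square_entry_occurs:
  assumes "latin_square n L" "i < n" "j < n" "c \<in> {1..n}"
  obtains i' j' where "i' < n" "L (i', j) = c" "j' < n" "L (i, j') = c"
proof -
  have "c \<in> (\<lambda>i. L (i, j)) ` {..<n}" "c \<in> (\<lambda>j. L (i, j)) ` {..<n}"
    using assms by (simp_all add: latin_square_def bij_betw_def)
  then show thesis
    using that by auto
qed

lemma descent_free_smaller_entry_used:
  assumes latin: "latin_square n L" and free: "descent_free L U"
    and prefix: "lex_cells n = xs @ v # ys" and member: "v \<in> U" and color: "1 \<le> c" "c < L v"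
  shows "\<exists>u\<in>cells n - U \<union> set xs. rook_adj u v \<and> L u = c"
proof (rule ccontr)
  assume unused: "\<not> ?thesis"
  obtain i j where v_eq: "v = (i, j)" by fastforce
  have "v \<in> cells n"
    using prefix set_lex_cells[of n] by auto
  then have "i < n" "j < n" "c \<in> {1..n}"
    using color latin_square_range[OF latin, of v] by (auto simp: v_eq cells_def)
  then obtain i' j' where occurrences: "i' < n" "L (i', j) = c" "j' < n" "L (i, j') = c"
    using latin_square_entry_occurs[OF latin] by metis
  have later: "u \<in> U \<and> v < u" if "u \<in> {(i', j), (i, j')}" for u
  proof -
    have neighbor: "u \<in> cells n" "L u = c" "u \<noteq> v" "rook_adj u v"
      using that occurrences color \<open>i < n\<close> \<open>j < n\<close> by (auto simp: v_eq cells_def rook_adj_def)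
    then have "u \<notin> cells n - U \<union> set xs"
      using unused by blast
    then show ?thesis
      using neighbor(1) lex_cells_prefix[OF prefix neighbor(1)]
        less_linear[of u v] neighbor(3) by blast
  qed
  then have "{(i, j), (i', j), (i, j')} \<subseteq> U"
    using member by (simp add: v_eq)
  moreover have "i < i'" "j < j'"
    using later[of "(i', j)"] later[of "(i, j')"] occurrences color by (auto simp: v_eq)
  moreover have "L (i', j) = L (i, j')"
    using occurrences by simp
  ultimately have "L (i, j) \<le> L (i, j')"
    using free unfolding descent_free_def by presburger
  then show False
    using color occurrences v_eq by simp
qed

theorem greedy_defining_set_lex_Diff_descent_free:
  assumes latin: "latin_square n L" and free: "descent_free L U"
  shows "greedy_defining_set_lex n L (cells n - U)"
proof -
  have "first_fit_color rook_adj ((Some \<circ> L) |` (cells n - U \<union> set xs)) v = L v"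
    if prefix: "lex_cells n = xs @ v # ys" and "v \<notin> cells n - U" for xs v ys
  proof (rule first_fit_color_restrict_eqI)
    have in_cells: "v \<in> cells n" "set xs \<subseteq> cells n"
      using prefix set_lex_cells[of n] by auto
    show "1 \<le> L v"
      using latin_square_range[OF latin in_cells(1)] by simp
    show "L u \<noteq> L v" if "u \<in> cells n - U \<union> set xs" "rook_adj u v" for u
      using latin_square_adj_neq[OF latin] that in_cells by blast
    show "\<exists>u\<in>cells n - U \<union> set xs. rook_adj u v \<and> L u = c" if "1 \<le> c" "c < L v" for c
      using descent_free_smaller_entry_used[OF latin free prefix] that in_cells
        \<open>v \<notin> cells n - U\<close> by blast
  qed
  then have "first_fit rook_adj (lex_cells n) ((Some \<circ> L) |` (cells n - U)) =
      (Some \<circ> L) |` (cells n - U \<union> set (lex_cells n))"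
    by (rule first_fit_restrict_eqI)
  then show ?thesis
    by (simp add: greedy_defining_set_lex_def set_lex_cells)
qed

section \<open>Corner-free sets\<close>

definition increasing_corner_free :: "cell set \<Rightarrow> bool" where
  "increasing_corner_free U \<longleftrightarrow>
     (\<forall>i j d. i < i XOR d \<longrightarrow> j < j XOR d \<longrightarrow> \<not> {(i, j), (i XOR d, j), (i, j XOR d)} \<subseteq> U)"

lemma div_pow2_xor:
  fixes a b :: "'a::semiring_bit_operations"
  shows "(a XOR b) div 2 ^ k = (a div 2 ^ k) XOR (b div 2 ^ k)"
  by (simp flip: drop_bit_eq_div)

lemma mod_pow2_xor:
  fixes a b :: "'a::semiring_bit_operations"
  shows "(a XOR b) mod 2 ^ k = (a mod 2 ^ k) XOR (b mod 2 ^ k)"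
  by (simp flip: take_bit_eq_mod)

lemma xor_cancel_left:
  fixes a b :: "'a::semiring_bit_operations"
  shows "a XOR (a XOR b) = b"
  by (simp flip: xor.assoc)

lemma tensor_square_add_xor:
  assumes "i < 2 ^ k" "j < 2 ^ k"
  shows "tensor_square k (i, j) + (i XOR j) = 2 ^ k"
  using assms
proof (induction k arbitrary: i j)
  case (Suc k)
  have "x div 2 ^ k = of_bool (\<not> x < 2 ^ k)" if "x < 2 ^ Suc k" for x :: nat
    using that by (simp add: le_div_geq)
  then have "(i XOR j) div 2 ^ k = of_bool (i < 2 ^ k \<longleftrightarrow> \<not> j < 2 ^ k)"
    using Suc.prems by (simp add: div_pow2_xor)
  then have "i XOR j = of_bool (i < 2 ^ k \<longleftrightarrow> \<not> j < 2 ^ k) * 2 ^ k +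
      ((i mod 2 ^ k) XOR (j mod 2 ^ k))"
    by (metis div_mult_mod_eq mod_pow2_xor)
  then show ?case
    using Suc.IH[of "i mod 2 ^ k" "j mod 2 ^ k"] by simp
qed simp

lemma descent_free_tensor_square:
  assumes free: "increasing_corner_free U" "U \<subseteq> cells (2 ^ k)"
  shows "descent_free (tensor_square k) U"
  unfolding descent_free_def
proof (intro allI impI)
  fix i i' j j'
  assume less: "i < i'" "j < j'" and corner: "{(i, j), (i', j), (i, j')} \<subseteq> U"
    and entries: "tensor_square k (i', j) = tensor_square k (i, j')"
  have "i < 2 ^ k" "i' < 2 ^ k" "j < 2 ^ k" "j' < 2 ^ k"
    using corner free(2) by (auto simp: cells_def)
  then have "i' XOR j = i XOR j'"
    using entries tensor_square_add_xor[of i' k j] tensor_square_add_xor[of i k j'] by simp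
  then have "j' = i XOR (i' XOR j)"
    by (simp add: xor_cancel_left)
  then have "j' = j XOR (i XOR i')"
    by (simp add: ac_simps)
  moreover have "i' = i XOR (i XOR i')"
    by (simp add: xor_cancel_left)
  ultimately show "tensor_square k (i, j) \<le> tensor_square k (i, j')"
    using free(1) less corner unfolding increasing_corner_free_def by metis
qed

definition block_product :: "nat \<Rightarrow> cell set \<Rightarrow> cell set \<Rightarrow> cell set" where
  "block_product n A B = {(i, j). (i div n, j div n) \<in> A \<and> (i mod n, j mod n) \<in> B}"

lemma block_product_subset_cells:
  assumes "A \<subseteq> cells m" "B \<subseteq> cells n"
  shows "block_product n A B \<subseteq> cells (m * n)"
proof (cases "n = 0")
  case False
  then show ?thesis
    using assms by (auto simp: block_product_def cells_def div_less_iff_less_mult)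
qed (use assms in \<open>auto simp: block_product_def cells_def\<close>)

lemma card_block_product:
  assumes "B \<subseteq> cells n"
  shows "card (block_product n A B) = card A * card B"
proof -
  have "bij_betw (\<lambda>((a, b), (c, d)). (a * n + c, b * n + d)) (A \<times> B) (block_product n A B)"
    by (rule bij_betw_byWitness[where
          f' = "\<lambda>(i, j). ((i div n, j div n), (i mod n, j mod n))"])
      (use assms in \<open>auto simp: block_product_def cells_def\<close>)
  then show ?thesis
    by (metis bij_betw_same_card card_cartesian_product)
qed

lemma mod_less_xor_mod:
  fixes a d :: nat
  assumes "a < a XOR d" "d div 2 ^ k = 0"
  shows "a mod 2 ^ k < (a mod 2 ^ k) XOR (d mod 2 ^ k)"
proof -
  have "(a XOR d) div 2 ^ k = a div 2 ^ k"
    using assms(2) by (simp add: div_pow2_xor)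
  then have "a mod 2 ^ k < (a XOR d) mod 2 ^ k"
    using assms(1) by (metis div_mult_mod_eq nat_add_left_cancel_less)
  then show ?thesis
    by (simp add: mod_pow2_xor)
qed

lemma div_less_xor_div:
  fixes a d :: nat
  assumes "a < a XOR d" "d div 2 ^ k \<noteq> 0"
  shows "a div 2 ^ k < (a div 2 ^ k) XOR (d div 2 ^ k)"
proof -
  have "a div 2 ^ k \<noteq> (a div 2 ^ k) XOR (d div 2 ^ k)"
    using assms(2) by (metis xor_cancel_left xor_self_eq)
  moreover have "a div 2 ^ k \<le> (a XOR d) div 2 ^ k"
    using assms(1) by (simp add: div_le_mono)
  ultimately show ?thesis
    by (simp add: div_pow2_xor)
qed

lemma increasing_corner_free_block_product:
  assumes free_A: "increasing_corner_free A" and free_B: "increasing_corner_free B"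
  shows "increasing_corner_free (block_product (2 ^ k) A B)"
  unfolding increasing_corner_free_def
proof (intro allI impI notI)
  fix i j d
  assume less: "i < i XOR d" "j < j XOR d"
    and corner: "{(i, j), (i XOR d, j), (i, j XOR d)} \<subseteq> block_product (2 ^ k) A B"
  show False
  proof (cases "d div 2 ^ k = 0")
    case True
    have "{(i mod 2 ^ k, j mod 2 ^ k), ((i mod 2 ^ k) XOR (d mod 2 ^ k), j mod 2 ^ k),
        (i mod 2 ^ k, (j mod 2 ^ k) XOR (d mod 2 ^ k))} \<subseteq> B"
      using corner by (simp add: block_product_def mod_pow2_xor)
    then show False
      using free_B less[THEN mod_less_xor_mod, OF True]
      unfolding increasing_corner_free_def by blast
  next
    case False
    have "{(i div 2 ^ k, j div 2 ^ k), ((i div 2 ^ k) XOR (d div 2 ^ k), j div 2 ^ k),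
        (i div 2 ^ k, (j div 2 ^ k) XOR (d div 2 ^ k))} \<subseteq> A"
      using corner by (simp add: block_product_def div_pow2_xor)
    then show False
      using free_A less[THEN div_less_xor_div, OF False]
      unfolding increasing_corner_free_def by blast
  qed
qed

lemma increasing_corner_free_power:
  assumes free: "increasing_corner_free A" "A \<subseteq> cells (2 ^ m)"
  shows "\<exists>U \<subseteq> cells (2 ^ k). increasing_corner_free U \<and> card U = card A ^ (k div m)"
proof (induction k rule: less_induct)
  case (less k)
  show ?case
  proof (cases "m = 0 \<or> k < m")
    case True
    then have "k div m = 0" by auto
    then show ?thesis
      by (intro exI[of _ "{(0, 0)}"]) (auto simp: cells_def increasing_corner_free_def)
  next
    case False
    then obtain U where U: "U \<subseteq> cells (2 ^ (k - m))" "increasing_corner_free U"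
      and card: "card U = card A ^ ((k - m) div m)"
      using less[of "k - m"] by auto
    let ?V = "block_product (2 ^ (k - m)) A U"
    have "?V \<subseteq> cells (2 ^ k)"
      using block_product_subset_cells[OF free(2) U(1)] False by (simp flip: power_add)
    moreover have "increasing_corner_free ?V"
      using free(1) U(2) by (rule increasing_corner_free_block_product)
    moreover have "card ?V = card A ^ (k div m)"
      using False by (simp add: card_block_product U(1) card le_div_geq)
    ultimately show ?thesis by blast
  qed
qed

section \<open>Greedy defining sets of tensor squares\<close>

lemma pow2_powr_le_power_div:
  fixes a b :: real
  assumes "0 < m" "0 \<le> a" "2 powr (real m * a) \<le> b"
  shows "real (2 ^ k) powr a \<le> b * b ^ (k div m)"
proof -
  have "k \<le> m * Suc (k div m)"
    using assms(1) by (simp add: dividend_less_times_div less_imp_le)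
  then have "real k * a \<le> real (m * Suc (k div m)) * a"
    using assms(2) by (intro mult_right_mono of_nat_mono)
  then have exponent: "real k * a \<le> real m * a * real (Suc (k div m))"
    by (simp add: algebra_simps)
  have "real (2 ^ k) powr a = (2 powr real k) powr a"
    by (simp add: powr_realpow)
  also have "\<dots> = 2 powr (real k * a)"
    by (rule powr_powr)
  also have "\<dots> \<le> 2 powr (real m * a * real (Suc (k div m)))"
    using exponent by (intro powr_mono) simp_all
  also have "\<dots> = (2 powr (real m * a)) ^ Suc (k div m)"
    by (simp only: powr_power mult.commute)
  also have "\<dots> \<le> b ^ Suc (k div m)"
    using assms(3) by (rule power_mono) simp
  finally show ?thesis by simp
qed

lemma card_cells_minus_card_Diff:
  assumes "U \<subseteq> cells n"
  shows "(real n)\<^sup>2 - real (card (cells n - U)) = real (card U)"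
proof -
  have "finite (cells n)" and "card (cells n) = n\<^sup>2"
    by (simp_all add: cells_def power2_eq_square)
  then have "card U + card (cells n - U) = n\<^sup>2"
    using assms by (metis card_Diff_subset card_mono finite_subset le_add_diff_inverse)
  then show ?thesis
    by (metis add_diff_cancel_right' of_nat_add of_nat_power)
qed

theorem greedy_defining_sets_tensor_square:
  assumes free: "increasing_corner_free A" "A \<subseteq> cells (2 ^ m)"
    and exponent: "0 < m" "0 \<le> a" "2 powr (real m * a) \<le> real (card A)"
  shows "\<exists>S. (\<forall>k. greedy_defining_set_lex (2 ^ k) (tensor_square k) (S k)) \<and>
    (\<lambda>k. (real (2 ^ k))\<^sup>2 - real (card (S k))) \<in> \<Omega>(\<lambda>k. real (2 ^ k) powr a)"
proof -
  obtain U where U: "U k \<subseteq> cells (2 ^ k)" "increasing_corner_free (U k)"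
    and card: "card (U k) = card A ^ (k div m)" for k
    using increasing_corner_free_power[OF free] by metis
  let ?S = "\<lambda>k. cells (2 ^ k) - U k"
  have "greedy_defining_set_lex (2 ^ k) (tensor_square k) (?S k)" for k
    using latin_square_tensor_square descent_free_tensor_square[OF U(2,1)]
    by (rule greedy_defining_set_lex_Diff_descent_free)
  moreover have "0 < real (card A)"
    using exponent(3) by (rule less_le_trans[rotated]) simp
  then have "(\<lambda>k. real (card (U k))) \<in> \<Omega>(\<lambda>k. real (2 ^ k) powr a)"
    using pow2_powr_le_power_div[OF exponent]
    by (intro landau_omega.bigI[of "1 / card A"]) (simp_all add: card field_simps)
  then have "(\<lambda>k. (real (2 ^ k))\<^sup>2 - real (card (?S k))) \<in> \<Omega>(\<lambda>k. real (2 ^ k) powr a)"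
    unfolding card_cells_minus_card_Diff[OF U(1)] .
  ultimately show ?thesis
    by (intro exI[of _ ?S]) simp
qed

section \<open>A corner-free set of 35 cells\<close>

definition base_cells :: "cell set" where
  "base_cells =
    {0} \<times> {0, 1, 4, 5} \<union>
    {1} \<times> {1, 3, 5, 6} \<union>
    {2} \<times> {0, 1, 2, 3, 6} \<union>
    {3} \<times> {4, 5, 6, 7} \<union>
    {4} \<times> {2, 4, 6} \<union>
    {5} \<times> {2, 3, 6, 7} \<union>
    {6} \<times> {0, 3, 5, 6, 7} \<union>
    {7} \<times> {0, 1, 2, 4, 5, 7}"

lemma base_cells_subset: "base_cells \<subseteq> cells (2 ^ 3)"
  by (auto simp: base_cells_def cells_def)

lemma card_base_cells: "card base_cells = 35"
  by (simp add: base_cells_def)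

lemma increasing_corner_free_base_cells: "increasing_corner_free base_cells"
  unfolding increasing_corner_free_def
proof (intro allI impI notI)
  fix i j d
  assume less: "i < i XOR d" "j < j XOR d"
    and corner: "{(i, j), (i XOR d, j), (i, j XOR d)} \<subseteq> base_cells"
  have "i div 2 ^ 3 = 0" "(i XOR d) div 2 ^ 3 = 0"
    using corner base_cells_subset by (auto simp: cells_def)
  then have "(i XOR (i XOR d)) div 2 ^ 3 = 0"
    by (simp only: div_pow2_xor[of i]) simp
  then have "d < 8"
    by (simp add: xor_cancel_left)
  then have "d \<in> {0, 1, 2, 3, 4, 5, 6, 7}"
    by auto
  moreover have "\<forall>(i, j)\<in>base_cells. \<forall>d\<in>{0, 1, 2, 3, 4, 5, 6, 7}. i < i XOR d \<longrightarrow> j < j XOR d \<longrightarrow>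
      (i XOR d, j) \<in> base_cells \<longrightarrow> (i, j XOR d) \<notin> base_cells"
    by code_simp
  ultimately show False
    using less corner by fastforce
qed

theorem theorem12:
  shows "\<exists>S :: nat \<Rightarrow> cell set.
    (\<forall>k. greedy_defining_set_lex (2 ^ k) (tensor_square k) (S k)) \<and>
    (\<lambda>k. (real (2 ^ k))\<^sup>2 - real (card (S k))) \<in> \<Omega>(\<lambda>k. real (2 ^ k) powr 1.673)"
proof (rule greedy_defining_sets_tensor_square)
  have "((2 :: real) powr 5.1) ^ 10 \<le> 35 ^ 10"
    by (simp add: powr_power)
  then have "(2 :: real) powr 5.1 \<le> 35"
    by (rule power_le_imp_le_base[where n = 9, simplified]) simp
  moreover have "(2 :: real) powr (real 3 * 1.673) \<le> 2 powr 5.1"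
    by (rule powr_mono) simp_all
  ultimately show "2 powr (real 3 * 1.673) \<le> real (card base_cells)"
    unfolding card_base_cells by linarith
qed (simp_all add: increasing_corner_free_base_cells base_cells_subset[simplified])

end
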